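(* Let $G,M>0$ and let $\mathbf r:\mathbb R\to\mathbb R^2\setminus\{\mathbf 0\}$ be a twice differentiable solution of Newton's equation $\ddot{\mathbf r}(t)=-\dfrac{GM}{|\mathbf r(t)|^3}\,\mathbf r(t)$ for all $t\in\mathbb R$, with nonzero (constant) specific angular momentum $h=|\mathbf r\times\dot{\mathbf r}|\neq 0$. Then there exists a periapsis time $t_0\in\mathbb R$ such that, with $r_0=|\mathbf r(t_0)|$, $v_0=|\dot{\mathbf r}(t_0)|$, $\mathbf e=\mathbf r(t_0)/r_0$ and $$\epsilon:=\frac{r_0v_0^2-GM}{GM},$$ one has $\epsilon\ge 0$ and the following hold. (i) If $\epsilon=0$, then $|\mathbf r(t)|=r_0$ for all $t\in\mathbb R$, so the orbit is circular with center $\mathbf 0$. (ii) If $\epsilon>0$, let $\ell=\{\mathbf x\in\mathbb R^2:\mathbf x\cdot\mathbf e=r_0+r_0/\epsilon\}$ (the line perpendicular to the line through $\mathbf 0$ and the periapsis $\mathbf r(t_0)$, at distance $r_0/\epsilon$ from $\mathbf r(t_0)$, on the side of $\mathbf r(t_0)$ opposite to $\mathbf 0$). Then for all $t\in\mathbb R$, $$|\mathbf r(t)|=\epsilon\,\operatorname{dist}(\mathbf r(t),\ell).$$ That is, the orbit lies on the conic section with focus $\mathbf 0$, directrix $\ell$ and eccentricity $\epsilon$.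
   Context: The motion takes place in the plane, with the central mass $M$ fixed at the origin; $G$ is the gravitational constant. For $\mathbf a,\mathbf b\in\mathbb R^2$, $|\mathbf a\times\mathbf b|=|a_1b_2-a_2b_1|$. A periapsis time is a time $t_0$ at which $t\mapsto|\mathbf r(t)|$ attains its global minimum over $\mathbb R$; the point $\mathbf r(t_0)$ is called a periapsis. The focus–directrix property of a conic with focus $F$, directrix $\ell$ and eccentricity $\epsilon>0$ is that each of its points $P$ satisfies $|P-F|=\epsilon\,\operatorname{dist}(P,\ell)$. *)

theory Defs
  imports "HOL-Analysis.Analysis"
begin

definition cross2 :: "real ^ 2 \<Rightarrow> real ^ 2 \<Rightarrow> real" where
  "cross2 a b = a $ 1 * b $ 2 - a $ 2 * b $ 1"

definition periapsis_time :: "(real \<Rightarrow> real ^ 2) \<Rightarrow> real \<Rightarrow> bool" where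
  "periapsis_time r t0 \<longleftrightarrow> (\<forall>t. norm (r t0) \<le> norm (r t))"

text \<open>Points with the focus-directrix property. Note that \<^term>\<open>infdist P L\<close> is \<open>0\<close>
  by convention for empty \<open>L\<close>; the definition is meant for a line \<open>L\<close> and \<open>\<epsilon> > 0\<close>.\<close>

definition focus_directrix_conic :: "real ^ 2 \<Rightarrow> (real ^ 2) set \<Rightarrow> real \<Rightarrow> (real ^ 2) set" where
  "focus_directrix_conic F L \<epsilon> = {P. dist P F = \<epsilon> * infdist P L}"

end

theory Submission
  imports Defs
begin

text \<open>The angular momentum \<open>h\<close> and the Laplace-Runge-Lenz vector \<open>A\<close> are constant, and
  \<open>A \<bullet> r = h\<^sup>2 - k |r|\<close> with \<open>k = G M\<close>; at a periapsis \<open>A = k \<epsilon> e\<close>, and this identity is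
  the focus-directrix equation. A periapsis time must still be found. If \<open>|A| < k\<close> then
  \<open>|r|\<close> is bounded, so the polar angle has speed bounded away from \<open>0\<close> and passes the direction
  of \<open>A\<close>, where \<open>|r|\<close> is minimal. If \<open>|A| \<ge> k\<close> then \<open>r \<bullet> v\<close> has derivative at least
  \<open>k / |r|\<close>, which forces it to change sign, and \<open>|r|\<close> is minimal at its zero.\<close>

section \<open>Distance to a hyperplane, and growth from a derivative bound\<close>

text \<open>The foot \<open>Q\<close> of the perpendicular attains the distance, and Cauchy-Schwarz
  against the unit normal shows that no point of the hyperplane is closer.\<close>

lemma infdist_hyperplane:
  fixes e P :: "'a::real_inner"
  assumes "norm e = 1"
  shows "infdist P {x. x \<bullet> e = c} = \<bar>P \<bullet> e - c\<bar>"
proof (rule antisym)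
  have ee: "e \<bullet> e = 1"
    using assms by (simp add: dot_square_norm)
  define Q where "Q = P - (P \<bullet> e - c) *\<^sub>R e"
  have Q: "Q \<in> {x. x \<bullet> e = c}"
    by (simp add: Q_def inner_diff_left ee)
  have "infdist P {x. x \<bullet> e = c} \<le> dist P Q"
    by (rule infdist_le[OF Q])
  also have "dist P Q = \<bar>P \<bullet> e - c\<bar>"
    by (simp add: Q_def dist_norm assms)
  finally show "infdist P {x. x \<bullet> e = c} \<le> \<bar>P \<bullet> e - c\<bar>" .
  have "\<bar>P \<bullet> e - c\<bar> \<le> dist P z" if "z \<in> {x. x \<bullet> e = c}" for z
    using Cauchy_Schwarz_ineq2[of "P - z" e] that assms by (simp add: inner_diff_left dist_norm)
  then show "\<bar>P \<bullet> e - c\<bar> \<le> infdist P {x. x \<bullet> e = c}"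
    unfolding infdist_def using Q by (auto intro!: cINF_greatest)
qed

lemma deriv_bounded_below_imp_unbounded:
  fixes f f' :: "real \<Rightarrow> real"
  assumes "\<And>t. t \<ge> 0 \<Longrightarrow> (f has_real_derivative f' t) (at t)"
    and "\<And>t. t \<ge> 0 \<Longrightarrow> f' t \<ge> c" and "c > 0"
  shows "\<exists>t\<ge>0. f t > b"
proof -
  \<comment> \<open>At this time a slope of at least \<open>c\<close> has produced a gain of at
    least \<open>\<bar>b - f 0\<bar> + 1\<close>, which carries \<open>f\<close> past
    \<open>b\<close>.\<close>
  define T where "T = (\<bar>b - f 0\<bar> + 1) / c"
  have T: "T > 0" using assms(3) by (simp add: T_def)
  obtain z where z: "0 < z" "f T - f 0 = (T - 0) * f' z"
    using MVT2[of 0 T f f'] T assms(1) by auto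
  have "T * c \<le> T * f' z"
    using assms(2)[of z] z T by (intro mult_left_mono) auto
  moreover have "T * c = \<bar>b - f 0\<bar> + 1"
    using assms(3) by (simp add: T_def)
  ultimately show ?thesis
    using z T by (intro exI[of _ T]) auto
qed

section \<open>Radial motion and angular momentum in coordinates\<close>

text \<open>Position is \<open>(x, y)\<close> and velocity \<open>(p, q)\<close>; with scalar
  functions, the vector identities become polynomial identities. The nonzero cross product keeps the
  orbit off the origin.\<close>

locale kepler_orbit =
  fixes k :: real and x y p q :: "real \<Rightarrow> real"
  assumes k_pos: "k > 0"
    and cross_nonzero: "\<And>t. x t * q t - y t * p t \<noteq> 0"
    and x_deriv: "\<And>t. (x has_real_derivative p t) (at t)"
    and y_deriv: "\<And>t. (y has_real_derivative q t) (at t)"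
    and newton_x: "\<And>t. (p has_real_derivative - (k / sqrt ((x t)\<^sup>2 + (y t)\<^sup>2) ^ 3) * x t) (at t)"
    and newton_y: "\<And>t. (q has_real_derivative - (k / sqrt ((x t)\<^sup>2 + (y t)\<^sup>2) ^ 3) * y t) (at t)"
begin

definition \<rho> :: "real \<Rightarrow> real" where "\<rho> t = sqrt ((x t)\<^sup>2 + (y t)\<^sup>2)"
definition h :: "real \<Rightarrow> real" where "h t = x t * q t - y t * p t"
text \<open>This is the inner product of position and velocity, half the derivative of
  \<open>\<rho>\<^sup>2\<close>; its sign decides whether the distance grows or shrinks.\<close>

definition g :: "real \<Rightarrow> real" where "g t = x t * p t + y t * q t"

lemma h_nonzero: "h t \<noteq> 0"
  using cross_nonzero by (simp add: h_def)

lemma p_deriv: "(p has_real_derivative - (k / \<rho> t ^ 3) * x t) (at t)"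
  and q_deriv: "(q has_real_derivative - (k / \<rho> t ^ 3) * y t) (at t)"
  unfolding \<rho>_def by (rule newton_x newton_y)+

lemma rho_pos: "\<rho> t > 0"
proof -
  have "x t \<noteq> 0 \<or> y t \<noteq> 0"
    using h_nonzero[of t] by (auto simp: h_def)
  then show ?thesis
    by (simp add: \<rho>_def sum_power2_gt_zero_iff)
qed

lemma rho_sq: "(\<rho> t)\<^sup>2 = (x t)\<^sup>2 + (y t)\<^sup>2"
  by (simp add: \<rho>_def)

lemma rho_deriv: "(\<rho> has_real_derivative g t / \<rho> t) (at t)"
proof -
  have "(x t)\<^sup>2 + (y t)\<^sup>2 > 0"
    using rho_pos[of t] rho_sq[of t] by (metis zero_less_power)
  then show ?thesis
    unfolding \<rho>_def g_def
    by (auto intro!: derivative_eq_intros x_deriv y_deriv simp: divide_simps mult_ac)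
qed

lemma rho_nonincreasing:
  assumes "s \<le> t" and "\<And>u. s \<le> u \<Longrightarrow> u \<le> t \<Longrightarrow> g u \<le> 0"
  shows "\<rho> t \<le> \<rho> s"
proof (rule DERIV_nonpos_imp_nonincreasing[OF assms(1)])
  fix u assume "s \<le> u" "u \<le> t"
  then have "g u / \<rho> u \<le> 0"
    using assms(2) rho_pos by (simp add: divide_nonpos_pos)
  then show "\<exists>d. (\<rho> has_real_derivative d) (at u) \<and> d \<le> 0"
    using rho_deriv by blast
qed

lemma rho_nondecreasing:
  assumes "s \<le> t" and "\<And>u. s \<le> u \<Longrightarrow> u \<le> t \<Longrightarrow> 0 \<le> g u"
  shows "\<rho> s \<le> \<rho> t"
proof (rule DERIV_nonneg_imp_nondecreasing[OF assms(1)])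
  fix u assume "s \<le> u" "u \<le> t"
  then have "0 \<le> g u / \<rho> u"
    using assms(2) rho_pos by (simp add: less_imp_le)
  then show "\<exists>d. (\<rho> has_real_derivative d) (at u) \<and> 0 \<le> d"
    using rho_deriv by blast
qed

lemma h_constant: "h t = h 0"
proof -
  have "\<forall>t. (h has_real_derivative 0) (at t)"
    unfolding h_def
    by (auto intro!: derivative_eq_intros x_deriv y_deriv p_deriv q_deriv)
  then show ?thesis by (rule DERIV_isconst_all)
qed

text \<open>Lagrange-Jacobi identity: the force contributes the inner product of position and
  acceleration, which is \<open>- k / \<rho> t\<close>.\<close>

lemma g_deriv: "(g has_real_derivative (p t)\<^sup>2 + (q t)\<^sup>2 - k / \<rho> t) (at t)"
proof -
  have "(g has_real_derivative
      (p t)\<^sup>2 + (q t)\<^sup>2 - k / \<rho> t ^ 3 * ((x t)\<^sup>2 + (y t)\<^sup>2)) (at t)"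
    unfolding g_def
    by (auto intro!: derivative_eq_intros x_deriv y_deriv p_deriv q_deriv
        simp: algebra_simps power2_eq_square)
  then show ?thesis
    using rho_pos[of t] unfolding rho_sq[symmetric] by (simp add: power2_eq_square power3_eq_cube)
qed

section \<open>The Laplace-Runge-Lenz vector and the orbit equation\<close>

text \<open>\<open>A1\<close> and \<open>A2\<close> are the components of the Laplace-Runge-Lenz
  vector: velocity crossed with the normal vector of length \<open>h\<close>, minus \<open>k\<close>
  times the radial unit vector.\<close>

definition A1 :: "real \<Rightarrow> real" where "A1 t = h t * q t - k * x t / \<rho> t"
definition A2 :: "real \<Rightarrow> real" where "A2 t = - h t * p t - k * y t / \<rho> t"
definition \<alpha> :: real where "\<alpha> = sqrt ((A1 0)\<^sup>2 + (A2 0)\<^sup>2)"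

lemma h_deriv: "(h has_real_derivative 0) (at t)"
  using h_constant by (metis DERIV_const ext)

lemma A1_constant: "A1 t = A1 0"
proof -
  have "(A1 has_real_derivative 0) (at t)" for t
  proof -
    \<comment> \<open>Zero is rewritten as the expression that the product and quotient rules yield
      for \<open>A1\<close>; \<open>subst e\<close> then lets those rules match the goal.\<close>
    have e: "0 = h t * (- (k / \<rho> t ^ 3) * y t)
        - (k * p t * \<rho> t - k * x t * (g t / \<rho> t)) / (\<rho> t * \<rho> t)"
    proof -
      have "(p t * (\<rho> t)\<^sup>2 - x t * g t) + h t * y t = 0"
        unfolding rho_sq g_def h_def by algebra
      moreover have "(k * p t * \<rho> t - k * x t * (g t / \<rho> t)) * \<rho> t = k * (p t * (\<rho> t)\<^sup>2 - x t * g t)"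
        using rho_pos[of t] by (simp add: left_diff_distrib right_diff_distrib power2_eq_square)
      ultimately have "(k * p t * \<rho> t - k * x t * (g t / \<rho> t)) * \<rho> t = - k * h t * y t"
        by algebra
      then have "k * p t * \<rho> t - k * x t * (g t / \<rho> t) = (- k * h t * y t) / \<rho> t"
        using rho_pos[of t] by (metis nonzero_eq_divide_eq less_irrefl)
      then show ?thesis
        using rho_pos[of t] by (simp add: power3_eq_cube mult_ac)
    qed
    show ?thesis
      unfolding A1_def using rho_pos[of t]
      by (subst e) (auto intro!: derivative_eq_intros h_deriv x_deriv q_deriv rho_deriv
          simp: mult_ac)
  qed
  then show ?thesis using DERIV_isconst_all by blast
qed

lemma A2_constant: "A2 t = A2 0"
proof -
  have "(A2 has_real_derivative 0) (at t)" for t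
  proof -
    have e: "0 = - h t * (- (k / \<rho> t ^ 3) * x t)
        - (k * q t * \<rho> t - k * y t * (g t / \<rho> t)) / (\<rho> t * \<rho> t)"
    proof -
      have "(q t * (\<rho> t)\<^sup>2 - y t * g t) - h t * x t = 0"
        unfolding rho_sq g_def h_def by algebra
      moreover have "(k * q t * \<rho> t - k * y t * (g t / \<rho> t)) * \<rho> t = k * (q t * (\<rho> t)\<^sup>2 - y t * g t)"
        using rho_pos[of t] by (simp add: left_diff_distrib right_diff_distrib power2_eq_square)
      ultimately have "(k * q t * \<rho> t - k * y t * (g t / \<rho> t)) * \<rho> t = k * h t * x t"
        by algebra
      then have "k * q t * \<rho> t - k * y t * (g t / \<rho> t) = (k * h t * x t) / \<rho> t"
        using rho_pos[of t] by (metis nonzero_eq_divide_eq less_irrefl)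
      then show ?thesis
        using rho_pos[of t] by (simp add: power3_eq_cube mult_ac)
    qed
    show ?thesis
      unfolding A2_def using rho_pos[of t]
      by (subst e) (auto intro!: derivative_eq_intros h_deriv y_deriv p_deriv rho_deriv
          simp: mult_ac)
  qed
  then show ?thesis using DERIV_isconst_all by blast
qed

text \<open>\<open>X\<close> and \<open>W\<close> are the inner and cross products of A with the
  position, that is \<open>\<alpha> * \<rho>\<close> times the cosine and sine of the angle from A
  to it.\<close>

definition X :: "real \<Rightarrow> real" where "X t = A1 0 * x t + A2 0 * y t"
definition W :: "real \<Rightarrow> real" where "W t = A1 0 * y t - A2 0 * x t"

lemma alpha_nonneg: "\<alpha> \<ge> 0" and alpha_sq: "\<alpha>\<^sup>2 = (A1 0)\<^sup>2 + (A2 0)\<^sup>2"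
  by (simp_all add: \<alpha>_def)

lemma orbit_equation: "X t = (h 0)\<^sup>2 - k * \<rho> t"
proof -
  have "X t = A1 t * x t + A2 t * y t"
    using A1_constant[of t] A2_constant[of t] by (simp add: X_def)
  also have "\<dots> = (h t)\<^sup>2 - k * ((x t)\<^sup>2 + (y t)\<^sup>2) / \<rho> t"
    using rho_pos[of t] unfolding A1_def A2_def h_def by (simp add: field_simps power2_eq_square)
  also have "\<dots> = (h 0)\<^sup>2 - k * \<rho> t"
    using rho_pos[of t] h_constant[of t]
    unfolding rho_sq[symmetric] by (simp add: power2_eq_square)
  finally show ?thesis .
qed

lemma X_W_sq: "(X t)\<^sup>2 + (W t)\<^sup>2 = (\<alpha> * \<rho> t)\<^sup>2"
  unfolding power_mult_distrib alpha_sq rho_sq X_def W_def by algebra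

text \<open>Cauchy-Schwarz for A and the position. With \<open>orbit_equation\<close> it confines
  \<open>(h 0)\<^sup>2\<close> between \<open>(k - \<alpha>) * \<rho> t\<close> and
  \<open>(k + \<alpha>) * \<rho> t\<close>.\<close>

lemma abs_X_le: "\<bar>X t\<bar> \<le> \<alpha> * \<rho> t"
proof (rule power2_le_imp_le)
  show "\<bar>X t\<bar>\<^sup>2 \<le> (\<alpha> * \<rho> t)\<^sup>2"
    unfolding X_W_sq[symmetric, of t] by simp
  show "0 \<le> \<alpha> * \<rho> t"
    using alpha_nonneg rho_pos[of t] by simp
qed

text \<open>Conservation of energy, from solving the definition of A for the velocity and squaring.
  The energy has the sign of \<open>\<alpha> - k\<close>.\<close>

lemma speed_sq: "(h 0)\<^sup>2 * ((p t)\<^sup>2 + (q t)\<^sup>2) = \<alpha>\<^sup>2 - k\<^sup>2 + 2 * k * (h 0)\<^sup>2 / \<rho> t"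
proof -
  have q: "h 0 * q t = A1 0 + k * x t / \<rho> t" and p: "h 0 * p t = - A2 0 - k * y t / \<rho> t"
    using A1_constant[of t] A2_constant[of t] h_constant[of t] by (auto simp: A1_def A2_def)
  have "(h 0)\<^sup>2 * ((p t)\<^sup>2 + (q t)\<^sup>2) = (h 0 * p t)\<^sup>2 + (h 0 * q t)\<^sup>2"
    by algebra
  also have "\<dots> = \<alpha>\<^sup>2 + 2 * k * X t / \<rho> t + k\<^sup>2 * (((x t)\<^sup>2 + (y t)\<^sup>2) / (\<rho> t)\<^sup>2)"
    unfolding p q alpha_sq X_def using rho_pos[of t]
    by (simp add: field_simps power2_eq_square)
  also have "\<dots> = \<alpha>\<^sup>2 + 2 * k * X t / \<rho> t + k\<^sup>2"
    using rho_pos[of t] by (simp add: rho_sq[symmetric])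
  also have "\<dots> = \<alpha>\<^sup>2 - k\<^sup>2 + 2 * k * (h 0)\<^sup>2 / \<rho> t"
    using rho_pos[of t] unfolding orbit_equation by (simp add: field_simps power2_eq_square)
  finally show ?thesis .
qed

section \<open>Existence of a periapsis\<close>

text \<open>\<open>W / (\<alpha> \<rho> - X)\<close> is the cotangent of half the angle from \<open>A\<close> to the position vector; it is
  defined as long as the orbit does not meet the ray spanned by \<open>A\<close>.\<close>

lemma half_angle_deriv:
  assumes "\<And>t. X t < \<alpha> * \<rho> t"
  shows "((\<lambda>t. arctan (W t / (\<alpha> * \<rho> t - X t))) has_real_derivative
      - h 0 / (2 * (\<rho> t)\<^sup>2)) (at t)"
proof -
  define D where "D = \<alpha> * \<rho> t - X t"
  define X' where "X' = A1 0 * p t + A2 0 * q t"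
  define W' where "W' = A1 0 * q t - A2 0 * p t"
  have D: "D > 0" using assms[of t] by (simp add: D_def)
  have \<alpha>: "\<alpha> > 0"
    using D abs_X_le[of t] rho_pos[of t] alpha_nonneg by (cases "\<alpha> = 0") (auto simp: D_def)
  have dX: "(X has_real_derivative X') (at t)"
    unfolding X_def X'_def by (auto intro!: derivative_eq_intros x_deriv y_deriv)
  have dW: "(W has_real_derivative W') (at t)"
    unfolding W_def W'_def by (auto intro!: derivative_eq_intros x_deriv y_deriv)
  \<comment> \<open>\<open>(X, W)\<close> is the position rotated and scaled by \<alpha>, so its
    angular momentum is \<open>\<alpha>\<^sup>2 * h t\<close>.\<close>
  have 1: "W' * X t - W t * X' = \<alpha>\<^sup>2 * h t"
    unfolding alpha_sq X_def W_def X'_def W'_def h_def by algebra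
  have 2: "W' * (\<rho> t)\<^sup>2 - W t * g t = h t * X t"
    unfolding rho_sq X_def W_def W'_def h_def g_def by algebra
  have num: "(W' * D - W t * (\<alpha> * (g t / \<rho> t) - X')) * \<rho> t = - \<alpha> * h t * D"
  proof -
    have "(W' * D - W t * (\<alpha> * (g t / \<rho> t) - X')) * \<rho> t =
        \<alpha> * (W' * (\<rho> t)\<^sup>2 - W t * g t) - (W' * X t - W t * X') * \<rho> t"
      using rho_pos[of t] unfolding D_def by (simp add: field_simps power2_eq_square)
    then show ?thesis unfolding 1 2 D_def by algebra
  qed
  \<comment> \<open>In terms of the angle this is the half-angle identity 1 + cot^2 = 2 / (1 - cos),
    which clears the denominator left by the arctangent.\<close>
  have den: "D\<^sup>2 + (W t)\<^sup>2 = 2 * \<alpha> * \<rho> t * D"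
    using X_W_sq[of t] unfolding D_def by algebra
  have "1 + (W t / D)\<^sup>2 = 2 * \<alpha> * \<rho> t / D"
    using D den by (simp add: field_simps power2_eq_square)
  then have e: "inverse (1 + (W t / D)\<^sup>2)
      * ((W' * D - W t * (\<alpha> * (g t / \<rho> t) - X')) / (D * D)) = - h 0 / (2 * (\<rho> t)\<^sup>2)"
  proof -
    have n: "W' * D - W t * (\<alpha> * (g t / \<rho> t) - X') = - \<alpha> * h t * D / \<rho> t"
      using num rho_pos[of t] by (metis nonzero_eq_divide_eq less_irrefl)
    show ?thesis
      using D \<alpha> rho_pos[of t] h_constant[of t]
      unfolding n \<open>1 + (W t / D)\<^sup>2 = _\<close> by (simp add: divide_simps power2_eq_square)
  qed
  show ?thesis
    unfolding e[symmetric] using D unfolding D_def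
    by (auto intro!: derivative_eq_intros dX dW rho_deriv)
qed

text \<open>The claim is equality in \<open>X t \<le> \<alpha> * \<rho> t\<close>. If it never
  occurred, the half angle would be a bounded function whose speed stays away from zero.\<close>

lemma periapsis_if_elliptic:
  assumes "\<alpha> < k"
  shows "\<exists>t0. (k + \<alpha>) * \<rho> t0 = (h 0)\<^sup>2"
proof (rule ccontr)
  assume "\<not> ?thesis"
  then have "X t \<noteq> \<alpha> * \<rho> t" for t
    using orbit_equation[of t] by (auto simp: algebra_simps)
  then have X: "X t < \<alpha> * \<rho> t" for t
    using abs_X_le[of t] by (metis abs_le_D1 less_le)
  define B where "B = (h 0)\<^sup>2 / (k - \<alpha>)"
  have B: "\<rho> t \<le> B" for t
    using abs_X_le[of t] orbit_equation[of t] assms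
    by (simp add: B_def field_simps abs_le_iff)
  have "B > 0"
    using B[of 0] rho_pos[of 0] by linarith
  \<comment> \<open>The sign of \<open>h 0\<close> makes \<psi> increasing for either orientation of
    the motion.\<close>
  define \<psi> where "\<psi> t = - sgn (h 0) * arctan (W t / (\<alpha> * \<rho> t - X t))" for t
  have "(\<psi> has_real_derivative \<bar>h 0\<bar> / (2 * (\<rho> t)\<^sup>2)) (at t)" for t
    unfolding \<psi>_def
    by (rule DERIV_cong[OF DERIV_cmult[OF half_angle_deriv[OF X]]]) (simp add: abs_sgn)
  moreover have "\<bar>h 0\<bar> / (2 * (\<rho> t)\<^sup>2) \<ge> \<bar>h 0\<bar> / (2 * B\<^sup>2)" for t
    using B[of t] rho_pos[of t] by (intro divide_left_mono mult_left_mono power_mono) auto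
  ultimately obtain t where t: "\<psi> t > \<psi> 0 + pi"
    using deriv_bounded_below_imp_unbounded[of \<psi> "\<lambda>t. \<bar>h 0\<bar> / (2 * (\<rho> t)\<^sup>2)" "\<bar>h 0\<bar> / (2 * B\<^sup>2)"
        "\<psi> 0 + pi"] \<open>B > 0\<close> h_nonzero by auto
  have "\<bar>\<psi> s\<bar> < pi / 2" for s
    using arctan_bounded[of "W s / (\<alpha> * \<rho> s - X s)"] h_nonzero[of 0]
    by (auto simp: \<psi>_def abs_mult abs_sgn_eq abs_less_iff)
  from this[of t] this[of 0] t show False
    by linarith
qed

text \<open>If \<open>g\<close> stayed negative, \<rho> would not exceed \<open>\<rho> 0\<close> at
  later times, so \<open>g\<close> would grow at rate at least \<open>k / \<rho> 0\<close> and
  become positive. Looking backwards excludes \<open>g\<close> staying positive.\<close>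

lemma ex_radial_turning_point:
  assumes "\<And>t. (p t)\<^sup>2 + (q t)\<^sup>2 - k / \<rho> t \<ge> k / \<rho> t"
  shows "\<exists>t. g t = 0"
proof -
  define g' where "g' t = (p t)\<^sup>2 + (q t)\<^sup>2 - k / \<rho> t" for t
  have dg: "(g has_real_derivative g' t) (at t)" for t
    using g_deriv by (simp add: g'_def)
  have c: "k / \<rho> 0 > 0"
    using k_pos rho_pos by simp
  have g': "g' t \<ge> k / \<rho> 0" if "\<rho> t \<le> \<rho> 0" for t
  proof -
    have "k / \<rho> 0 \<le> k / \<rho> t"
      using that rho_pos k_pos by (intro divide_left_mono) auto
    then show ?thesis using assms[of t] by (simp add: g'_def)
  qed
  have up: "\<exists>t. g t \<ge> 0"
  proof (rule ccontr)
    assume n: "\<not> ?thesis"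
    have "\<rho> t \<le> \<rho> 0" if "t \<ge> 0" for t
      using that n by (intro rho_nonincreasing) (auto simp: not_le less_imp_le)
    then obtain t where "g t > 0"
      using deriv_bounded_below_imp_unbounded[OF dg g' c] by blast
    then show False
      using n less_imp_le by blast
  qed
  \<comment> \<open>Time reversal: \<open>- g (- t)\<close> has derivative \<open>g' (- t)\<close>,
    so the forward argument applies to it.\<close>
  have down: "\<exists>t. g t \<le> 0"
  proof (rule ccontr)
    assume n: "\<not> ?thesis"
    have "\<rho> t \<le> \<rho> 0" if "t \<le> 0" for t
      using that n by (intro rho_nondecreasing) (auto simp: not_le less_imp_le)
    then have "g' (- t) \<ge> k / \<rho> 0" if "t \<ge> 0" for t
      using g' that by simp
    moreover have "((\<lambda>t. - g (- t)) has_real_derivative g' (- t)) (at t)" for t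
      by (rule DERIV_cong[OF DERIV_minus[OF DERIV_chain2[OF dg DERIV_minus[OF DERIV_ident]]]]) simp
    ultimately obtain t where "- g (- t) > 0"
      using deriv_bounded_below_imp_unbounded[of "\<lambda>t. - g (- t)" "\<lambda>t. g' (- t)" "k / \<rho> 0" 0] c
      by blast
    then show False
      using n less_imp_le neg_0_less_iff_less by blast
  qed
  obtain a b where "g a \<ge> 0" "g b \<le> 0"
    using up down by blast
  moreover have "connected (range g)"
    using dg by (intro connected_continuous_image connected_UNIV)
      (auto intro!: continuous_at_imp_continuous_on DERIV_isCont)
  ultimately have "0 \<in> range g"
    using connectedD_interval[of "range g" "g b" "g a" 0] by blast
  then show ?thesis by auto
qed

text \<open>The second conjunct is what makes the eccentricity nonnegative.\<close>

lemma periapsis_exists: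
  "\<exists>t0. (\<forall>t. \<rho> t0 \<le> \<rho> t) \<and> k \<le> \<rho> t0 * ((p t0)\<^sup>2 + (q t0)\<^sup>2)"
proof (cases "\<alpha> < k")
  case True
  then obtain t0 where t0: "(k + \<alpha>) * \<rho> t0 = (h 0)\<^sup>2"
    using periapsis_if_elliptic by blast
  have "\<rho> t0 \<le> \<rho> t" for t
  proof -
    have "(k + \<alpha>) * \<rho> t0 \<le> (k + \<alpha>) * \<rho> t"
      using abs_X_le[of t] orbit_equation[of t] t0 by (simp add: algebra_simps abs_le_iff)
    then show ?thesis
      using k_pos alpha_nonneg by simp
  qed
  moreover have "\<rho> t0 * ((p t0)\<^sup>2 + (q t0)\<^sup>2) = k + \<alpha>"
  proof -
    have "(h 0)\<^sup>2 * (\<rho> t0 * ((p t0)\<^sup>2 + (q t0)\<^sup>2)) = (\<alpha>\<^sup>2 - k\<^sup>2) * \<rho> t0 + 2 * k * (h 0)\<^sup>2"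
      using speed_sq[of t0] rho_pos[of t0] by (simp add: field_simps)
    also have "\<dots> = (h 0)\<^sup>2 * (k + \<alpha>)"
      unfolding t0[symmetric] by algebra
    finally show ?thesis
      using h_nonzero by simp
  qed
  ultimately show ?thesis
    using alpha_nonneg by (intro exI[of _ t0]) auto
next
  case False
  \<comment> \<open>Here the energy is nonnegative, so the squared speed is at least
    \<open>2 * k / \<rho> t\<close>.\<close>
  have accel: "(p t)\<^sup>2 + (q t)\<^sup>2 - k / \<rho> t \<ge> k / \<rho> t" for t
  proof -
    have "\<alpha>\<^sup>2 - k\<^sup>2 \<ge> 0"
      using False k_pos by (simp add: power_mono)
    then have "(h 0)\<^sup>2 * (2 * k / \<rho> t) \<le> (h 0)\<^sup>2 * ((p t)\<^sup>2 + (q t)\<^sup>2)"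
      unfolding speed_sq by (simp add: mult.commute mult.left_commute)
    then have "2 * k / \<rho> t \<le> (p t)\<^sup>2 + (q t)\<^sup>2"
      by (rule mult_left_le_imp_le) (simp add: h_nonzero)
    then show ?thesis by simp
  qed
  have g_mono: "g s \<le> g t" if "s \<le> t" for s t
  proof (rule DERIV_nonneg_imp_nondecreasing[OF that])
    fix u
    have "0 \<le> k / \<rho> u"
      using k_pos rho_pos[of u] by simp
    then have "0 \<le> (p u)\<^sup>2 + (q u)\<^sup>2 - k / \<rho> u"
      using accel[of u] by linarith
    then show "\<exists>d. (g has_real_derivative d) (at u) \<and> 0 \<le> d"
      using g_deriv by blast
  qed
  obtain t0 where t0: "g t0 = 0"
    using ex_radial_turning_point[OF accel] by blast
  have "\<rho> t0 \<le> \<rho> t" for t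
  proof (cases "t0 \<le> t")
    case True
    then show ?thesis
      using g_mono[of t0] t0 by (intro rho_nondecreasing) auto
  next
    case False
    then show ?thesis
      using g_mono[of _ t0] t0 by (intro rho_nonincreasing) auto
  qed
  moreover have "k \<le> \<rho> t0 * ((p t0)\<^sup>2 + (q t0)\<^sup>2)"
    using accel[of t0] rho_pos[of t0] k_pos by (simp add: field_simps)
  ultimately show ?thesis by blast
qed

section \<open>The conic equation\<close>

text \<open>At a minimum of \<rho> the velocity is perpendicular to the position. There A is
  \<open>V - k / \<rho> t0\<close> times the position, and \<open>orbit_equation\<close> takes this
  form.\<close>

lemma focal_equation:
  assumes "\<And>t. \<rho> t0 \<le> \<rho> t"
  defines "V \<equiv> (p t0)\<^sup>2 + (q t0)\<^sup>2"
  shows "k * \<rho> t = V * (\<rho> t0)\<^sup>2 - (V - k / \<rho> t0) * (x t0 * x t + y t0 * y t)"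
proof -
  have "g t0 / \<rho> t0 = 0"
    using DERIV_local_min[OF rho_deriv zero_less_one] assms(1) by blast
  then have g: "x t0 * p t0 + y t0 * q t0 = 0"
    using rho_pos[of t0] by (simp add: g_def)
  have "h t0 * q t0 = V * x t0" "h t0 * p t0 = - V * y t0" "(h t0)\<^sup>2 = V * (\<rho> t0)\<^sup>2"
    using g unfolding h_def V_def rho_sq by algebra+
  then have "A1 0 = (V - k / \<rho> t0) * x t0" "A2 0 = (V - k / \<rho> t0) * y t0"
    using A1_constant[of t0] A2_constant[of t0] by (auto simp: A1_def A2_def algebra_simps)
  then have "X t = (V - k / \<rho> t0) * (x t0 * x t + y t0 * y t)"
    unfolding X_def by algebra
  with \<open>(h t0)\<^sup>2 = _\<close> show ?thesis
    using orbit_equation[of t] h_constant[of t0] by simp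
qed

end

section \<open>Return to vectors in the plane\<close>

theorem mainTheorem1:
  fixes G M :: real and r v :: "real \<Rightarrow> real ^ 2"
  assumes "G > 0" and "M > 0"
    and "\<And>t. r t \<noteq> 0"
    and "\<And>t. (r has_vector_derivative v t) (at t)"
    and "\<And>t. (v has_vector_derivative (- (G * M / norm (r t) ^ 3)) *\<^sub>R r t) (at t)"
    and "\<And>t. \<bar>cross2 (r t) (v t)\<bar> \<noteq> 0"
  shows "\<exists>t0. periapsis_time r t0 \<and>
    (let r0 = norm (r t0);
         v0 = norm (v t0);
         e = r t0 /\<^sub>R r0;
         \<epsilon> = (r0 * v0\<^sup>2 - G * M) / (G * M)
     in \<epsilon> \<ge> 0 \<and>
        (\<epsilon> = 0 \<longrightarrow> (\<forall>t. norm (r t) = r0) \<and> range r \<subseteq> sphere 0 r0) \<and>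
        (\<epsilon> > 0 \<longrightarrow>
          (let L = {x. x \<bullet> e = r0 + r0 / \<epsilon>}
           in (\<forall>t. norm (r t) = \<epsilon> * infdist (r t) L) \<and>
              range r \<subseteq> focus_directrix_conic 0 L \<epsilon>)))"
proof -
  define k where "k = G * M"
  have k: "k > 0" using assms(1,2) by (simp add: k_def)
  have norm2: "norm z = sqrt ((z $ 1)\<^sup>2 + (z $ 2)\<^sup>2)" for z :: "real ^ 2"
    by (simp add: norm_vec_def L2_set_def sum_2)
  have comp: "((\<lambda>t. f t $ i) has_real_derivative f' $ i) (at t)"
    if "(f has_vector_derivative f') (at t)" for f :: "real \<Rightarrow> real ^ 2" and f' t i
    using bounded_linear.has_vector_derivative[OF bounded_linear_vec_nth that]
    by (simp add: has_real_derivative_iff_has_vector_derivative)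
  interpret K: kepler_orbit k "\<lambda>t. r t $ 1" "\<lambda>t. r t $ 2" "\<lambda>t. v t $ 1" "\<lambda>t. v t $ 2"
  proof
    show "r t $ 1 * v t $ 2 - r t $ 2 * v t $ 1 \<noteq> 0" for t
      using assms(6)[of t] by (simp add: cross2_def)
  qed (use k comp[OF assms(4)] comp[OF assms(5)] in \<open>auto simp: k_def norm2\<close>)
  have \<rho>: "K.\<rho> t = norm (r t)" for t
    by (simp add: K.\<rho>_def norm2)
  have V: "(v t $ 1)\<^sup>2 + (v t $ 2)\<^sup>2 = (norm (v t))\<^sup>2" for t
    by (simp add: norm2)
  obtain t0 where peri: "\<And>t. norm (r t0) \<le> norm (r t)"
    and kV: "k \<le> norm (r t0) * (norm (v t0))\<^sup>2"
    using K.periapsis_exists unfolding \<rho> V by blast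
  define r0 where "r0 = norm (r t0)"
  define v0 where "v0 = norm (v t0)"
  define e where "e = r t0 /\<^sub>R r0"
  define \<epsilon> where "\<epsilon> = (r0 * v0\<^sup>2 - k) / k"
  have r0: "r0 > 0" using assms(3) by (simp add: r0_def)
  have e1: "norm e = 1" using r0 by (simp add: e_def r0_def)
  have \<epsilon>: "\<epsilon> \<ge> 0" using kV k by (simp add: \<epsilon>_def r0_def v0_def)
  have v0: "v0\<^sup>2 = k * (1 + \<epsilon>) / r0"
    using r0 k by (simp add: \<epsilon>_def field_simps)
  \<comment> \<open>The focal equation divided by \<open>k\<close>; for zero eccentricity it already
    says that the distance is constant.\<close>
  have conic: "norm (r t) = r0 * (1 + \<epsilon>) - \<epsilon> * (r t \<bullet> e)" for t
  proof -
    have inner: "r t0 $ 1 * r t $ 1 + r t0 $ 2 * r t $ 2 = r0 * (r t \<bullet> e)"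
      using r0 by (simp add: e_def inner_vec_def sum_2 field_simps)
    have "k * norm (r t) = v0\<^sup>2 * r0\<^sup>2 - (v0\<^sup>2 - k / r0) * (r0 * (r t \<bullet> e))"
      using K.focal_equation[of t0 t] peri unfolding \<rho> V inner r0_def[symmetric] v0_def[symmetric]
      by blast
    also have "\<dots> = k * (r0 * (1 + \<epsilon>) - \<epsilon> * (r t \<bullet> e))"
      using r0 unfolding v0 by (simp add: field_simps power2_eq_square)
    finally show ?thesis using k by simp
  qed
  have focus_directrix: "norm (r t) = \<epsilon> * infdist (r t) {x. x \<bullet> e = r0 + r0 / \<epsilon>}"
    if "\<epsilon> > 0" for t
  proof -
    have "norm (r t) = - (\<epsilon> * (r t \<bullet> e - (r0 + r0 / \<epsilon>)))"
      using conic[of t] that by (simp add: algebra_simps)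
    \<comment> \<open>The left side is a norm, so the orbit lies on the focus side of the directrix
      and the absolute value costs only a sign.\<close>
    then have "norm (r t) = \<bar>\<epsilon> * (r t \<bullet> e - (r0 + r0 / \<epsilon>))\<bar>"
      using norm_ge_zero[of "r t"] by linarith
    then show ?thesis
      using that by (simp add: infdist_hyperplane[OF e1] abs_mult)
  qed
  have "periapsis_time r t0"
    using peri by (simp add: periapsis_time_def)
  moreover have "\<forall>t. norm (r t) = r0" if "\<epsilon> = 0"
    using conic that by simp
  ultimately show ?thesis
    using \<epsilon> focus_directrix
    by (intro exI[of _ t0])
      (unfold Let_def r0_def[symmetric] v0_def[symmetric] e_def[symmetric] k_def[symmetric]
        \<epsilon>_def[symmetric] focus_directrix_conic_def, auto simp: dist_norm)
qed

end
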